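(* Let $D$ be a convex set of a real linear space $X$. Let $\mathscr{A}$ be a sigma algebra containing the Borel subsets of $[0,1]$ and let $\mu$ be a probability measure on $([0,1],\mathscr{A})$ such that the support of $\mu$ is not a singleton. Denote $$\mu_1:=\int_{[0,1]}t\,d\mu(t)\qquad\text{and}\qquad S(\mu):=\mu([0,\mu_1])\int_{]\mu_1,1]}t\,d\mu(t)-\mu(]\mu_1,1])\int_{[0,\mu_1]}t\,d\mu(t).$$ Assume that $f:D\to\mathbb{R}$ is a hemi-$\mu$-integrable solution of the functional inequality $$f((1-t)x+ty)\le(1-t)f(x)+tf(y)+\eta_{x,y}(t)\qquad((x,y)\in D^{2*},\ t\in[0,1]),$$ where, for all $(x,y)\in D^{2*}$, $\eta_{x,y}:[0,1]\to\mathbb{R}$ is a function such that $$I(x,y):=\int_{]\mu_1,1]}\int_{[0,\mu_1]}(t''-t')\,\eta_{(1-t')x+t'y,\,(1-t'')x+t''y}\Big(\frac{\mu_1-t'}{t''-t'}\Big)d\mu(t')\,d\mu(t'')$$ exists in $[-\infty,\infty]$ for all $(x,y)\in D^{2*}$. Then the function $f$ also satisfies the lower Hermite--Hadamard type inequality $$f((1-\mu_1)x+\mu_1y)\le\int_{[0,1]}f((1-t)x+ty)\,d\mu(t)+\frac{1}{S(\mu)}I(x,y)\qquad((x,y)\in D^{2*}).$$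
   Context: $D^{2*}:=\{(x,y)\mid x,y\in D,\ x\ne y\}$. A function $f:D\to\mathbb{R}$ is hemi-$\mu$-integrable if, for all $x,y\in D$, the mapping $t\mapsto f((1-t)x+ty)$ $(t\in[0,1])$ is $\mu$-integrable. *)

theory Defs
  imports "HOL-Probability.Probability"
begin

definition offdiag :: "'a set \<Rightarrow> ('a \<times> 'a) set" where
  "offdiag D = {(x, y). x \<in> D \<and> y \<in> D \<and> x \<noteq> y}"

definition hemi_integrable ::
    "real measure \<Rightarrow> 'a::real_vector set \<Rightarrow> ('a \<Rightarrow> real) \<Rightarrow> bool" where
  "hemi_integrable M D f \<longleftrightarrow>
     (\<forall>x\<in>D. \<forall>y\<in>D. integrable M (\<lambda>t. f ((1 - t) *\<^sub>R x + t *\<^sub>R y)))"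

definition measure_support :: "'a::topological_space measure \<Rightarrow> 'a set" where
  "measure_support M =
     {x \<in> space M. \<forall>U. open U \<and> x \<in> U \<longrightarrow> emeasure M (U \<inter> space M) > 0}"

definition first_moment :: "real measure \<Rightarrow> real" where
  "first_moment M = (LINT t|M. t)"

definition S_mu :: "real measure \<Rightarrow> real" where
  "S_mu M =
     measure M {0..first_moment M} * (LINT t:{first_moment M<..1}|M. t)
     - measure M {first_moment M<..1} * (LINT t:{0..first_moment M}|M. t)"

text \<open>
  Integrals with values in \<open>[-\<infinity>, \<infinity>]\<close>: the integral exists if the function is measurable and
  its positive and negative parts do not both have infinite integral. Note that
  \<^const>\<open>e2ennreal\<close> sends negative numbers to 0, so it yields the positive part.
\<close>

definition ext_integrable :: "'a measure \<Rightarrow> ('a \<Rightarrow> ereal) \<Rightarrow> bool" where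
  "ext_integrable M g \<longleftrightarrow> g \<in> borel_measurable M \<and>
     ((\<integral>\<^sup>+ x. e2ennreal (g x) \<partial>M) < \<infinity> \<or> (\<integral>\<^sup>+ x. e2ennreal (- g x) \<partial>M) < \<infinity>)"

definition ext_integral :: "'a measure \<Rightarrow> ('a \<Rightarrow> ereal) \<Rightarrow> ereal" where
  "ext_integral M g =
     enn2ereal (\<integral>\<^sup>+ x. e2ennreal (g x) \<partial>M) - enn2ereal (\<integral>\<^sup>+ x. e2ennreal (- g x) \<partial>M)"

text \<open>
  The iterated integral of \<open>k s t\<close>, first over \<open>t\<close> with respect to \<open>M\<close>, then over \<open>s\<close> with
  respect to \<open>N\<close>, exists in \<open>[-\<infinity>, \<infinity>]\<close> and equals \<open>c\<close>. As usual, the inner integral is only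
  required to exist for almost every \<open>s\<close>; \<open>J\<close> is then determined up to a null set, so \<open>c\<close> is
  unique.
\<close>

definition has_iterated_integral ::
    "'b measure \<Rightarrow> 'a measure \<Rightarrow> ('b \<Rightarrow> 'a \<Rightarrow> ereal) \<Rightarrow> ereal \<Rightarrow> bool" where
  "has_iterated_integral N M k c \<longleftrightarrow>
     (\<exists>J. (AE s in N. ext_integrable M (k s) \<and> ext_integral M (k s) = J s) \<and>
          ext_integrable N J \<and> ext_integral N J = c)"

end

theory Submission
  imports Defs
begin

text \<open>
  Write \<open>A = [0, \<mu>\<^sub>1]\<close>, \<open>B = ]\<mu>\<^sub>1, 1]\<close>, \<open>u\<^sub>t = (1 - t) x + t y\<close> and \<open>p = u\<^bsub>\<mu>\<^sub>1\<^esub>\<close>. For \<open>t' \<in> A\<close> and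
  \<open>t'' \<in> B\<close> the point \<open>p\<close> divides the segment from \<open>u\<^bsub>t'\<^esub>\<close> to \<open>u\<^bsub>t''\<^esub>\<close> in the ratio
  \<open>(\<mu>\<^sub>1 - t') : (t'' - \<mu>\<^sub>1)\<close>, so the functional inequality, multiplied by \<open>t'' - t' > 0\<close>, reads
  \<open>(t'' - t') f p \<le> (t'' - \<mu>\<^sub>1) f u\<^bsub>t'\<^esub> + (\<mu>\<^sub>1 - t') f u\<^bsub>t''\<^esub> + (t'' - t') \<eta>\<close>. Integrating over \<open>A\<close> and
  then over \<open>B\<close> gives \<open>S f p \<le> S \<integral> f u\<^sub>t d\<mu> + I\<close>, because
  \<open>S = \<integral>\<^sub>A (\<mu>\<^sub>1 - t) d\<mu> = \<integral>\<^sub>B (t - \<mu>\<^sub>1) d\<mu>\<close>. These two expressions also show that \<open>S = 0\<close> would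
  force \<open>\<mu>\<close> to be the Dirac measure at \<open>\<mu>\<^sub>1\<close>.
\<close>

section \<open>Comparison of real integrals with extended and iterated ones\<close>

lemma integral_le_ext_integral:
  fixes g :: "'a \<Rightarrow> real"
  assumes g: "integrable M g" and le: "AE x in M. ereal (g x) \<le> k x"
  shows "ereal (integral\<^sup>L M g) \<le> ext_integral M k"
proof -
  \<comment> \<open>Both parts of \<open>g\<close> have finite integrals. As the negative part of
    \<open>k\<close> lies below that of \<open>g\<close>, neither difference of parts below has the
    form \<infinity> - \<infinity>.\<close>
  have fin: "(\<integral>\<^sup>+ x. ennreal (g x) \<partial>M) < \<infinity>" "(\<integral>\<^sup>+ x. ennreal (- g x) \<partial>M) < \<infinity>"
    using g by (auto simp: real_integrable_def top.not_eq_extremum)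
  have pos: "(\<integral>\<^sup>+ x. ennreal (g x) \<partial>M) \<le> (\<integral>\<^sup>+ x. e2ennreal (k x) \<partial>M)"
  proof (rule nn_integral_mono_AE)
    show "AE x in M. ennreal (g x) \<le> e2ennreal (k x)"
      using le by eventually_elim (simp flip: e2ennreal_ereal add: e2ennreal_mono)
  qed
  have neg: "(\<integral>\<^sup>+ x. e2ennreal (- k x) \<partial>M) \<le> (\<integral>\<^sup>+ x. ennreal (- g x) \<partial>M)"
  proof (rule nn_integral_mono_AE)
    show "AE x in M. e2ennreal (- k x) \<le> ennreal (- g x)"
      using le
      by eventually_elim
        (metis e2ennreal_ereal e2ennreal_mono ereal_minus_le_minus uminus_ereal.simps(1))
  qed
  have "ereal (integral\<^sup>L M g) =
      enn2ereal (\<integral>\<^sup>+ x. ennreal (g x) \<partial>M) - enn2ereal (\<integral>\<^sup>+ x. ennreal (- g x) \<partial>M)"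
    using fin g by (cases "\<integral>\<^sup>+ x. ennreal (g x) \<partial>M"; cases "\<integral>\<^sup>+ x. ennreal (- g x) \<partial>M")
      (auto simp: real_lebesgue_integral_def enn2ereal_ennreal)
  also have "\<dots> \<le> ext_integral M k"
    unfolding ext_integral_def
    using pos neg by (intro ereal_minus_mono) (auto simp: less_eq_ennreal.rep_eq)
  finally show ?thesis .
qed

text \<open>Monotonicity is applied twice, inside and outside. \<open>J\<close> agrees with the
  inner integral only almost everywhere, so the outer comparison is an \<open>AE\<close>
  one.\<close>

lemma integral_le_iterated_integral:
  fixes g :: "'b \<Rightarrow> 'a \<Rightarrow> real"
  assumes k: "has_iterated_integral N M k c"
    and inner: "\<And>s. s \<in> space N \<Longrightarrow> integrable M (g s)"
    and outer: "integrable N (\<lambda>s. integral\<^sup>L M (g s))"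
    and le: "\<And>s t. s \<in> space N \<Longrightarrow> t \<in> space M \<Longrightarrow> ereal (g s t) \<le> k s t"
  shows "ereal (\<integral>s. integral\<^sup>L M (g s) \<partial>N) \<le> c"
proof -
  obtain J where J: "AE s in N. ext_integral M (k s) = J s" and c: "ext_integral N J = c"
    using k unfolding has_iterated_integral_def by (auto elim: eventually_mono)
  have "AE s in N. ereal (integral\<^sup>L M (g s)) \<le> J s"
    using J AE_space
  proof eventually_elim
    case (elim s)
    have "ereal (integral\<^sup>L M (g s)) \<le> ext_integral M (k s)"
      using elim(2) by (intro integral_le_ext_integral inner AE_I2 le)
    then show ?case
      unfolding elim(1) .
  qed
  then show ?thesis
    using integral_le_ext_integral[OF outer] c by blast
qed

section \<open>Points on a segment\<close>

lemma affine_combination_of_affine_combinations: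
  fixes x y :: "'a::real_vector" and a b m :: real
  assumes "a \<noteq> b"
  defines "l \<equiv> (m - a) / (b - a)"
  shows "(1 - l) *\<^sub>R ((1 - a) *\<^sub>R x + a *\<^sub>R y) + l *\<^sub>R ((1 - b) *\<^sub>R x + b *\<^sub>R y)
    = (1 - m) *\<^sub>R x + m *\<^sub>R y"
proof -
  \<comment> \<open>\<open>l\<close> is the weight for which \<open>(1 - l) * a + l * b = m\<close>;
    the claim carries this over to the affine map from parameters to points.\<close>
  have "l * (b - a) = m - a"
    using assms by simp
  then have m: "m = a + l * (b - a)"
    by simp
  show ?thesis
    unfolding m by (simp add: algebra_simps)
qed

text \<open>The two points differ by \<open>(a - b) *\<^sub>R (y - x)\<close>. This provides pairs
  of distinct points, the only ones for which the functional inequality is assumed.\<close>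

lemma affine_combination_inj:
  fixes x y :: "'a::real_vector"
  assumes "x \<noteq> y" "(1 - a) *\<^sub>R x + a *\<^sub>R y = (1 - b) *\<^sub>R x + b *\<^sub>R y"
  shows "a = b"
proof -
  have "(a - b) *\<^sub>R (y - x) = 0"
    using assms(2) by (simp add: algebra_simps)
  then show ?thesis
    using assms(1) by simp
qed

section \<open>Probability measures on the unit interval, split at the mean\<close>

locale unit_interval_prob = prob_space M for M :: "real measure" +
  assumes space_eq: "space M = {0..1}"
    and borel_sets: "sets (restrict_space borel {0..1}) \<subseteq> sets M"
begin

abbreviation "m \<equiv> first_moment M"
abbreviation "A \<equiv> {0..m}"
abbreviation "B \<equiv> {m<..1}"

text \<open>The sigma algebra of \<open>M\<close> may be larger than the Borel one, so measurability
  is transferred in one direction: from Borel sets to \<open>M\<close>.\<close>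

lemma borel_subset_sets:
  assumes "X \<in> sets borel" "X \<subseteq> {0..1}"
  shows "X \<in> sets M"
  using assms borel_sets by (auto simp: sets_restrict_space Int_absorb1 subset_eq image_iff)

lemma integrable_ident: "integrable M (\<lambda>t. t)"
proof (rule integrable_const_bound[where B = 1])
  show "AE t in M. norm t \<le> 1"
    by (intro AE_I2) (auto simp: space_eq)
  show "(\<lambda>t. t) \<in> borel_measurable M"
    by (rule measurableI) (auto simp: space_eq intro!: borel_subset_sets)
qed

lemma first_moment_bounds: "0 \<le> m" "m \<le> 1"
proof -
  show "0 \<le> m"
    unfolding first_moment_def by (intro integral_nonneg_AE AE_I2) (auto simp: space_eq)
  have "m \<le> (LINT t|M. 1)"
    unfolding first_moment_def
    by (intro integral_mono integrable_ident) (auto simp: space_eq)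
  then show "m \<le> 1"
    by (simp add: prob_space)
qed

lemma sets_A: "A \<in> sets M" and sets_B: "B \<in> sets M"
  using first_moment_bounds by (auto intro!: borel_subset_sets)

lemma space_split: "space M = A \<union> B" "A \<inter> B = {}"
  using first_moment_bounds by (auto simp: space_eq)

lemma integral_split:
  fixes g :: "real \<Rightarrow> real"
  assumes "integrable M g"
  shows "integrable (restrict_space M A) g" "integrable (restrict_space M B) g"
    and "integral\<^sup>L M g = integral\<^sup>L (restrict_space M A) g + integral\<^sup>L (restrict_space M B) g"
proof -
  have 1: "set_integrable M A g" "set_integrable M B g"
    using assms sets_A sets_B
    unfolding set_integrable_def by (intro integrable_mult_indicator; simp)+
  then show "integrable (restrict_space M A) g" "integrable (restrict_space M B) g"
    using sets_A sets_B by (auto simp: integrable_restrict_space set_integrable_def)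
  have "integral\<^sup>L M g = (LINT t:A \<union> B|M. g t)"
    using set_integral_space[OF assms] space_split by simp
  also have "\<dots> = (LINT t:A|M. g t) + (LINT t:B|M. g t)"
    using 1 space_split by (intro set_integral_Un)
  finally show "integral\<^sup>L M g = integral\<^sup>L (restrict_space M A) g + integral\<^sup>L (restrict_space M B) g"
    using sets_A sets_B by (simp add: integral_restrict_space set_lebesgue_integral_def)
qed

lemma measure_restrict:
  "measure (restrict_space M A) (space (restrict_space M A)) = prob A"
  "measure (restrict_space M B) (space (restrict_space M B)) = prob B"
  using sets_A sets_B space_split(1)
  by (auto simp: measure_restrict_space space_restrict_space Int_absorb1 Int_absorb2)

text \<open>The deviation \<open>t - m\<close> has mean 0, so its integrals over \<open>A\<close>
  and \<open>B\<close> cancel; \<open>prob A + prob B = 1\<close> identifies their common absolute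
  value with \<open>S_mu M\<close>. The last form is the definition in terms of restricted
  measures.\<close>

lemma S_mu_eq:
  "S_mu M = (LINT t|restrict_space M A. m - t)" (is "_ = ?SA")
  "S_mu M = (LINT t|restrict_space M B. t - m)" (is "_ = ?SB")
  "S_mu M = prob A * (LINT t|restrict_space M B. t) - prob B * (LINT t|restrict_space M A. t)"
proof -
  let ?EA = "LINT t|restrict_space M A. t" and ?EB = "LINT t|restrict_space M B. t"
  show S: "S_mu M = prob A * ?EB - prob B * ?EA"
    using sets_A sets_B by (simp add: S_mu_def integral_restrict_space set_lebesgue_integral_def)
  have m: "m = ?EA + ?EB"
    using integral_split(3)[OF integrable_ident] by (simp add: first_moment_def)
  have one: "prob A + prob B = 1"
    using finite_measure_Union[OF sets_A sets_B] space_split prob_space by simp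
  then have B: "prob B = 1 - prob A"
    by simp
  have "?SA = prob A * m - ?EA"
    using integral_split(1)[OF integrable_ident] integral_split(1)[of "\<lambda>_. m"]
    by (simp add: measure_restrict)
  then show "S_mu M = ?SA"
    unfolding S B by (subst (asm) m) (simp add: algebra_simps)
  have "?SB = ?EB - prob B * m"
    using integral_split(2)[OF integrable_ident] integral_split(2)[of "\<lambda>_. m"]
    by (simp add: measure_restrict)
  then show "S_mu M = ?SB"
    unfolding S B by (subst (asm) m) (simp add: algebra_simps)
qed

text \<open>Every neighbourhood of \<open>m\<close> has full measure, while the complement of
  \<open>{m}\<close> is open and null, which excludes all other points.\<close>

lemma measure_support_Dirac:
  assumes "AE t in M. t = m"
  shows "measure_support M = {m}"
proof -
  have "m \<in> measure_support M"
  proof -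
    have "emeasure M (U \<inter> space M) > 0" if "open U" "m \<in> U" for U
    proof -
      have "U \<inter> space M \<in> sets M"
        using that by (auto simp: space_eq intro!: borel_subset_sets)
      moreover have "AE t in M. t \<in> U \<inter> space M"
        using assms AE_space by eventually_elim (use that in auto)
      ultimately show ?thesis
        using emeasure_eq_1_AE by force
    qed
    then show ?thesis
      using first_moment_bounds by (auto simp: measure_support_def space_eq)
  qed
  moreover have "x = m" if "x \<in> measure_support M" for x
  proof (rule ccontr)
    assume "x \<noteq> m"
    moreover have "open (- {m})"
      by (intro open_Compl closed_singleton)
    ultimately have "emeasure M (- {m} \<inter> space M) > 0"
      using that unfolding measure_support_def by blast
    moreover have "emeasure M (- {m} \<inter> space M) = 0"
    proof -
      have "- {m} \<inter> space M \<in> sets M"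
        by (auto simp: space_eq intro!: borel_subset_sets)
      moreover have "AE t in M. t \<notin> - {m} \<inter> space M"
        using assms by eventually_elim auto
      ultimately show ?thesis
        using AE_iff_measurable[of "- {m} \<inter> space M" M "\<lambda>t. t \<notin> - {m} \<inter> space M"] by auto
    qed
    ultimately show False
      by simp
  qed
  ultimately show ?thesis
    by blast
qed

lemma S_mu_pos:
  assumes "\<not> is_singleton (measure_support M)"
  shows "S_mu M > 0"
proof (rule ccontr)
  assume "\<not> S_mu M > 0"
  have iA: "integrable (restrict_space M A) (\<lambda>t. m - t)"
    and iB: "integrable (restrict_space M B) (\<lambda>t. t - m)"
    using integral_split(1,2)[OF Bochner_Integration.integrable_diff[OF _ integrable_ident], of "\<lambda>_. m"]
      integral_split(1,2)[OF Bochner_Integration.integrable_diff[OF integrable_ident], of "\<lambda>_. m"]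
    by auto
  have nA: "AE t in restrict_space M A. 0 \<le> m - t"
    by (intro AE_I2) (auto simp: space_restrict_space)
  have nB: "AE t in restrict_space M B. 0 \<le> t - m"
    by (intro AE_I2) (auto simp: space_restrict_space)
  have "S_mu M = 0"
    using \<open>\<not> S_mu M > 0\<close> integral_nonneg_AE[OF nA] S_mu_eq(1) by simp
  \<comment> \<open>Both integrands are nonnegative with integral 0, hence vanish almost everywhere.
    Since \<open>t > m\<close> on \<open>B\<close>, this makes \<open>B\<close> a null set.\<close>
  then have "AE t in restrict_space M A. m - t = 0" "AE t in restrict_space M B. t - m = 0"
    using integral_nonneg_eq_0_iff_AE[OF iA nA] integral_nonneg_eq_0_iff_AE[OF iB nB] S_mu_eq(1,2)
    by auto
  then have "AE t in M. t \<in> A \<longrightarrow> t = m" "AE t in M. t \<in> B \<longrightarrow> t = m"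
    using sets_A sets_B by (auto simp: AE_restrict_space_iff elim: eventually_mono)
  then have "AE t in M. t = m"
    using AE_space by eventually_elim (use space_split(1) in auto)
  then show False
    using assms measure_support_Dirac by (simp add: is_singleton_def)
qed

text \<open>Only real functions remain: \<open>g\<close> plays the role of the given function along
  a segment, \<open>c\<close> of its value at the mean, \<open>k\<close> of the weighted error.
  Integrating \<open>le\<close> twice gives every term but \<open>k\<close> the factor
  \<open>S_mu M\<close>, by which one may divide.\<close>

lemma lower_hermite_hadamard:
  fixes g :: "real \<Rightarrow> real" and k :: "real \<Rightarrow> real \<Rightarrow> real"
  assumes g: "integrable M g"
    and S: "S_mu M > 0"
    and le: "\<And>t s. t \<in> A \<Longrightarrow> s \<in> B \<Longrightarrow> (s - t) * c \<le> (s - m) * g t + (m - t) * g s + k s t"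
    and k: "has_iterated_integral (restrict_space M B) (restrict_space M A)
      (\<lambda>s t. ereal (k s t)) I"
  shows "ereal c \<le> ereal (LINT t|M. g t) + ereal (1 / S_mu M) * I"
proof -
  let ?MA = "restrict_space M A" and ?MB = "restrict_space M B"
  \<comment> \<open>\<open>?h\<close> is the lower bound for \<open>k\<close> obtained from
    \<open>le\<close>, and \<open>?H\<close> its integral over \<open>A\<close>; the coefficient of
    \<open>g s\<close> is the integral of \<open>m - t\<close>, that is
    \<open>S_mu M\<close>.\<close>
  let ?h = "\<lambda>s t. (s - t) * c - (s - m) * g t - (m - t) * g s"
  let ?H = "\<lambda>s. (prob A * s - (LINT t|?MA. t)) * c - (s - m) * integral\<^sup>L ?MA g - S_mu M * g s"
  note intA [simp] = integral_split(1)[OF g] integral_split(1)[OF integrable_ident]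
  note intB [simp] = integral_split(2)[OF g] integral_split(2)[OF integrable_ident]
  have const [simp]: "integrable ?MA (\<lambda>_. r)" "integrable ?MB (\<lambda>_. r)" for r :: real
    using integral_split(1,2)[of "\<lambda>_. r"] by auto
  have inner: "integrable ?MA (?h s)" and "integral\<^sup>L ?MA (?h s) = ?H s" for s
    unfolding S_mu_eq(1) by (simp_all add: measure_restrict)
  then have H: "(\<lambda>s. integral\<^sup>L ?MA (?h s)) = ?H"
    by blast
  have outer: "integrable ?MB ?H"
    by simp
  \<comment> \<open>Integration over \<open>B\<close> turns the other two coefficients into
    \<open>S_mu M\<close> as well, through its third and second forms.\<close>
  have "integral\<^sup>L ?MB ?H =
      (prob A * (LINT t|?MB. t) - prob B * (LINT t|?MA. t)) * c
      - (LINT t|?MB. t - m) * integral\<^sup>L ?MA g - S_mu M * integral\<^sup>L ?MB g"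
    by (simp add: measure_restrict)
  also have "\<dots> = S_mu M * (c - (LINT t|M. g t))"
    unfolding S_mu_eq(3)[symmetric] S_mu_eq(2)[symmetric] integral_split(3)[OF g]
    by (simp add: algebra_simps)
  finally have eq: "integral\<^sup>L ?MB ?H = S_mu M * (c - (LINT t|M. g t))" .
  have "ereal (LINT s|?MB. integral\<^sup>L ?MA (?h s)) \<le> I"
  proof (rule integral_le_iterated_integral[OF k inner])
    show "integrable ?MB (\<lambda>s. integral\<^sup>L ?MA (?h s))"
      unfolding H by (rule outer)
    show "ereal (?h s t) \<le> ereal (k s t)" if "s \<in> space ?MB" "t \<in> space ?MA" for s t
      using le[of t s] that by (simp add: space_restrict_space algebra_simps)
  qed
  then have "ereal (S_mu M * (c - (LINT t|M. g t))) \<le> I"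
    unfolding H eq .
  \<comment> \<open>\<open>I\<close> may be infinite: -\<infinity> contradicts the real lower bound,
    and \<infinity> makes the right side infinite because \<open>S_mu M\<close> is positive.\<close>
  then show ?thesis
    using S by (cases I) (auto simp: field_simps)
qed

end

section \<open>Application to the segments of \<open>D\<close>\<close>

theorem theorem5:
  fixes D :: "'a::real_vector set"
    and M :: "real measure"
    and f :: "'a \<Rightarrow> real"
    and \<eta> :: "'a \<Rightarrow> 'a \<Rightarrow> real \<Rightarrow> real"
    and I :: "'a \<Rightarrow> 'a \<Rightarrow> ereal"
    and \<mu>\<^sub>1 :: real
  defines "\<mu>\<^sub>1 \<equiv> first_moment M"
  assumes "convex D"
    and "space M = {0..1}"
    and "sets (restrict_space borel {0..1}) \<subseteq> sets M"
    and "prob_space M"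
    and "\<not> is_singleton (measure_support M)"
    and "hemi_integrable M D f"
    and "\<forall>(x, y) \<in> offdiag D. \<forall>t \<in> {0..1}.
           f ((1 - t) *\<^sub>R x + t *\<^sub>R y) \<le> (1 - t) * f x + t * f y + \<eta> x y t"
    and "\<forall>(x, y) \<in> offdiag D.
           has_iterated_integral (restrict_space M {\<mu>\<^sub>1<..1}) (restrict_space M {0..\<mu>\<^sub>1})
             (\<lambda>t'' t'. ereal ((t'' - t') *
                \<eta> ((1 - t') *\<^sub>R x + t' *\<^sub>R y) ((1 - t'') *\<^sub>R x + t'' *\<^sub>R y)
                  ((\<mu>\<^sub>1 - t') / (t'' - t'))))
             (I x y)"
  shows "\<forall>(x, y) \<in> offdiag D.
           ereal (f ((1 - \<mu>\<^sub>1) *\<^sub>R x + \<mu>\<^sub>1 *\<^sub>R y))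
             \<le> ereal (LINT t|M. f ((1 - t) *\<^sub>R x + t *\<^sub>R y)) + ereal (1 / S_mu M) * I x y"
proof -
  interpret unit_interval_prob M
    using assms(3-5) by (simp add: unit_interval_prob_def unit_interval_prob_axioms_def)
  note D = assms(2) and hemi = assms(7) and ineq = assms(8) and k = assms(9)
  show ?thesis
  proof clarify
    fix x y
    assume xy: "(x, y) \<in> offdiag D"
    define u where "u t = (1 - t) *\<^sub>R x + t *\<^sub>R y" for t
    have uD: "u t \<in> D" if "t \<in> {0..1}" for t
      using that xy D by (auto simp: u_def offdiag_def intro: convexD)
    let ?l = "\<lambda>s t. (\<mu>\<^sub>1 - t) / (s - t)"
    have le: "(s - t) * f (u \<mu>\<^sub>1) \<le>
        (s - \<mu>\<^sub>1) * f (u t) + (\<mu>\<^sub>1 - t) * f (u s) + (s - t) * \<eta> (u t) (u s) (?l s t)"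
      if "t \<in> {0..\<mu>\<^sub>1}" "s \<in> {\<mu>\<^sub>1<..1}" for t s
    proof -
      have "t < s"
        using that by simp
      have "u t \<noteq> u s"
        using xy \<open>t < s\<close> affine_combination_inj[of x y t s] by (auto simp: u_def offdiag_def)
      then have "(u t, u s) \<in> offdiag D"
        using uD[of t] uD[of s] that by (simp add: offdiag_def)
      \<comment> \<open>This holds because \<open>0 \<le> \<mu>\<^sub>1 - t \<le> s - t\<close> and
        \<open>s - t > 0\<close>.\<close>
      moreover have "?l s t \<in> {0..1}"
        using that by (auto simp: field_simps)
      ultimately have "f ((1 - ?l s t) *\<^sub>R u t + ?l s t *\<^sub>R u s) \<le>
          (1 - ?l s t) * f (u t) + ?l s t * f (u s) + \<eta> (u t) (u s) (?l s t)"
        using ineq by blast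
      moreover have "(1 - ?l s t) *\<^sub>R u t + ?l s t *\<^sub>R u s = u \<mu>\<^sub>1"
        unfolding u_def using \<open>t < s\<close> by (intro affine_combination_of_affine_combinations) simp
      \<comment> \<open>The factor \<open>s - t\<close> clears the denominators of the weights and
        produces exactly the integrand of \<open>I x y\<close>.\<close>
      ultimately have "(s - t) * f (u \<mu>\<^sub>1) \<le>
          (s - t) * ((1 - ?l s t) * f (u t) + ?l s t * f (u s) + \<eta> (u t) (u s) (?l s t))"
        using \<open>t < s\<close> by (intro mult_left_mono) auto
      also have "\<dots> = ((s - t) * (1 - ?l s t)) * f (u t) + ((s - t) * ?l s t) * f (u s)
          + (s - t) * \<eta> (u t) (u s) (?l s t)"
        by (simp only: distrib_left mult.assoc)
      also have "(s - t) * (1 - ?l s t) = s - \<mu>\<^sub>1"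
        using \<open>t < s\<close> by (simp add: field_simps)
      also have "(s - t) * ?l s t = \<mu>\<^sub>1 - t"
        using \<open>t < s\<close> by simp
      finally show ?thesis .
    qed
    have int: "integrable M (\<lambda>t. f (u t))"
      using hemi xy by (auto simp: hemi_integrable_def u_def offdiag_def)
    have iter: "has_iterated_integral (restrict_space M {\<mu>\<^sub>1<..1}) (restrict_space M {0..\<mu>\<^sub>1})
        (\<lambda>s t. ereal ((s - t) * \<eta> (u t) (u s) (?l s t))) (I x y)"
      using k xy unfolding u_def by blast
    have "ereal (f (u \<mu>\<^sub>1)) \<le> ereal (LINT t|M. f (u t)) + ereal (1 / S_mu M) * I x y"
      unfolding \<mu>\<^sub>1_def
      by (rule lower_hermite_hadamard[OF int S_mu_pos[OF assms(6)]
            le[unfolded \<mu>\<^sub>1_def] iter[unfolded \<mu>\<^sub>1_def]])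
    then show "ereal (f ((1 - \<mu>\<^sub>1) *\<^sub>R x + \<mu>\<^sub>1 *\<^sub>R y))
        \<le> ereal (LINT t|M. f ((1 - t) *\<^sub>R x + t *\<^sub>R y)) + ereal (1 / S_mu M) * I x y"
      unfolding u_def .
  qed
qed

end
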